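(* Let $X$ be a real normed space and let $K\subset X$ be a convex body. Then the generalized Minkowski functional $\alpha(K,\cdot)\colon X\to\mathbb{R}$, $\mathbf{x}\mapsto\alpha(K,\mathbf{x})$, is a convex function on the whole space $X$.
   Context: $X$ is a real normed space, $X\neq\{0\}$; $X^*$ is its dual and $S^*$ the unit sphere of $X^*$. A convex body is a bounded, closed, convex set with nonempty interior. The support function of $K$ is $h(K,\mathbf{v}^* )=\sup_{\mathbf{x}\in K}\langle \mathbf{v}^*,\mathbf{x}\rangle$. For $\lambda\ge 0$ and $\mathbf{v}^*\in S^*$, with $r=-h(K,-\mathbf{v}^* )$ and $s=h(K,\mathbf{v}^* )$, set $$L^\lambda(K,\mathbf{v}^* )=\left\{\mathbf{x}\in X:\ \tfrac{\lambda+1}{2}r-\tfrac{\lambda-1}{2}s\le\langle\mathbf{v}^*,\mathbf{x}\rangle\le\tfrac{\lambda+1}{2}s-\tfrac{\lambda-1}{2}r\right\},\qquad K^\lambda=\bigcap_{\mathbf{v}^*\in S^*}L^\lambda(K,\mathbf{v}^* ).$$ The generalized Minkowski functional is $\alpha(K,\mathbf{x})=\inf\{\lambda\ge0:\mathbf{x}\in K^\lambda\}$, which is finite for every $\mathbf{x}\in X$. *)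

theory Defs
  imports "HOL-Analysis.Analysis"
begin

definition convex_body :: "'a::real_normed_vector set \<Rightarrow> bool" where
  "convex_body K \<longleftrightarrow> bounded K \<and> closed K \<and> convex K \<and> interior K \<noteq> {}"

text \<open>The dual space is the type of bounded linear functionals with the operator norm.\<close>

definition dual_sphere :: "('a::real_normed_vector \<Rightarrow>\<^sub>L real) set" where
  "dual_sphere = {v. norm v = 1}"

definition support_fun :: "'a::real_normed_vector set \<Rightarrow> ('a \<Rightarrow>\<^sub>L real) \<Rightarrow> real" where
  "support_fun K v = (SUP x\<in>K. blinfun_apply v x)"

definition scaled_layer ::
    "real \<Rightarrow> 'a::real_normed_vector set \<Rightarrow> ('a \<Rightarrow>\<^sub>L real) \<Rightarrow> 'a set" where
  "scaled_layer l K v =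
    (let r = - support_fun K (- v); s = support_fun K v in
      {x. (l + 1) / 2 * r - (l - 1) / 2 * s \<le> blinfun_apply v x \<and>
          blinfun_apply v x \<le> (l + 1) / 2 * s - (l - 1) / 2 * r})"

definition scaled_body :: "real \<Rightarrow> 'a::real_normed_vector set \<Rightarrow> 'a set" where
  "scaled_body l K = (\<Inter>v\<in>dual_sphere. scaled_layer l K v)"

text \<open>The infimum is taken in the reals, where the infimum of the empty set is a junk value.
  For a convex body this case does not arise: see \<open>minkowski_set_nonempty\<close> below.\<close>

definition gen_minkowski :: "'a::real_normed_vector set \<Rightarrow> 'a \<Rightarrow> real" where
  "gen_minkowski K x = Inf {l. 0 \<le> l \<and> x \<in> scaled_body l K}"

lemma support_fun_upper:
  assumes "bounded K" "x \<in> K"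
  shows "blinfun_apply v x \<le> support_fun K v"
proof -
  have "bounded (blinfun_apply v ` K)"
    using assms(1) by (rule bounded_linear_image) (rule blinfun.bounded_linear_right)
  then show ?thesis
    unfolding support_fun_def
    using assms(2) by (intro cSUP_upper bounded_imp_bdd_above) auto
qed

lemma support_fun_cball_upper:
  fixes v :: "'a::real_normed_vector \<Rightarrow>\<^sub>L real"
  assumes K: "bounded K" and e: "0 < e" "cball c e \<subseteq> K" and v: "norm v = 1"
  shows "blinfun_apply v c + e \<le> support_fun K v"
proof -
  let ?h = "support_fun K v - blinfun_apply v c"
  have unit: "e * blinfun_apply v u \<le> ?h" if "norm u = 1" for u
  proof -
    have "c + e *\<^sub>R u \<in> K"
      using e that by (auto simp: dist_norm subset_iff)
    from support_fun_upper[OF K this, of v] show ?thesis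
      by (simp add: blinfun.add_right blinfun.scaleR_right)
  qed
  have bound: "norm (blinfun_apply v y) \<le> ?h / e * norm y" for y
  proof (cases "y = 0")
    case False
    let ?u = "y /\<^sub>R norm y"
    have 1: "norm ?u = 1" "norm (- ?u) = 1" using False by simp_all
    have "e * \<bar>blinfun_apply v ?u\<bar> \<le> ?h"
      using unit[OF 1(1)] unit[OF 1(2)]
      by (auto simp: blinfun.minus_right abs_if simp del: norm_minus_cancel)
    then show ?thesis
      using False e by (simp add: blinfun.scaleR_right abs_mult field_simps)
  qed simp
  have "c \<in> K" using e by auto
  from support_fun_upper[OF K this, of v] have "0 \<le> ?h / e" using e by simp
  then have "norm v \<le> ?h / e" using bound by (rule norm_blinfun_bound)
  then show ?thesis using v e by (simp add: field_simps)
qed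

lemma minkowski_set_nonempty:
  assumes "convex_body K"
  shows "{l. 0 \<le> l \<and> x \<in> scaled_body l K} \<noteq> {}"
proof -
  from assms obtain c where "c \<in> interior K" and K: "bounded K"
    by (auto simp: convex_body_def)
  then obtain e where e: "0 < e" "cball c e \<subseteq> K"
    by (auto simp: mem_interior_cball)
  define d where "d = norm (x - c)"
  define l where "l = 1 + d / e"
  have d: "0 \<le> d" by (simp add: d_def)
  have "x \<in> scaled_layer l K v" if v: "norm v = 1" for v
  proof -
    define s where "s = support_fun K v"
    define t where "t = support_fun K (- v)"
    have s: "blinfun_apply v c + e \<le> s" unfolding s_def
      by (rule support_fun_cball_upper[OF K e v])
    have t: "- blinfun_apply v c + e \<le> t" unfolding t_def
      using support_fun_cball_upper[OF K e, of "- v"] v by (simp add: blinfun.minus_left)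
    have "\<bar>blinfun_apply v (x - c)\<bar> \<le> d"
      using norm_blinfun[of v "x - c"] v by (simp add: d_def)
    then have x: "\<bar>blinfun_apply v x - blinfun_apply v c\<bar> \<le> d"
      by (simp add: blinfun.diff_right)
    have "d / e * (2 * e) \<le> d / e * (s + t)"
      using s t d e by (intro mult_left_mono) auto
    then have "2 * d \<le> d / e * (s + t)" using e by simp
    define w where "w = (l - 1) * (s + t) / 2"
    have w: "d \<le> w" using \<open>2 * d \<le> d / e * (s + t)\<close> by (simp add: l_def w_def)
    have "(l + 1) / 2 * s - (l - 1) / 2 * (- t) = s + w"
      "(l + 1) / 2 * (- t) - (l - 1) / 2 * s = - t - w"
      by (simp_all add: w_def field_simps)
    moreover have "blinfun_apply v x \<le> s + w" "- t - w \<le> blinfun_apply v x"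
      using x s t e w by linarith+
    ultimately have "(l + 1) / 2 * (- t) - (l - 1) / 2 * s \<le> blinfun_apply v x"
      "blinfun_apply v x \<le> (l + 1) / 2 * s - (l - 1) / 2 * (- t)"
      by simp_all
    then show ?thesis
      unfolding scaled_layer_def Let_def s_def t_def by blast
  qed
  then have "x \<in> scaled_body l K" by (auto simp: scaled_body_def dual_sphere_def)
  moreover have "0 \<le> l" using d e by (simp add: l_def)
  ultimately show ?thesis by blast
qed

end

theory Submission
  imports Defs
begin

text \<open>
  Each layer is the strip \<open>{x. \<bar>v x - m\<bar> \<le> l * w}\<close> whose midvalue \<open>m\<close> and half-width \<open>w\<close> depend only on
  \<open>K\<close> and \<open>v\<close>. Its two inequalities are affine in the pair \<open>(l, x)\<close>, so the set of all pairs with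
  \<open>0 \<le> l\<close> and \<open>x\<close> in the scaled body is an intersection of half-spaces of \<open>\<real> \<times> X\<close>, hence convex.
  The generalized Minkowski functional is the lower boundary of this set, and minimizing one
  coordinate over a convex set leaves a convex function of the other
  (\<open>convex_on_Inf_fiber\<close>). Finiteness of the functional enters as nonemptiness of the fibers.
\<close>

text \<open>
  Points of the fibers over \<open>x\<close> and \<open>y\<close> that are within \<open>e\<close> of the infima combine to a point of the
  fiber over the combination of \<open>x\<close> and \<open>y\<close>. Nonempty fibers bounded below are assumed because only
  for them is the real infimum meaningful.
\<close>

lemma convex_on_Inf_fiber:
  fixes C :: "(real \<times> 'a::real_vector) set"
  assumes C: "convex C"
    and nonempty: "\<And>x. {l. (l, x) \<in> C} \<noteq> {}"
    and bdd: "\<And>x. bdd_below {l. (l, x) \<in> C}"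
  shows "convex_on UNIV (\<lambda>x. Inf {l. (l, x) \<in> C})"
proof (intro convex_onI)
  fix t :: real and x y :: 'a
  assume t: "0 < t" "t < 1"
  let ?g = "\<lambda>x. Inf {l. (l, x) \<in> C}"
  show "?g ((1 - t) *\<^sub>R x + t *\<^sub>R y) \<le> (1 - t) * ?g x + t * ?g y"
  proof (rule field_le_epsilon)
    fix e :: real assume "0 < e"
    have near: "\<exists>l. (l, z) \<in> C \<and> l < ?g z + e" for z
      using cInf_lessD[OF nonempty[of z], of "?g z + e"] \<open>0 < e\<close> by auto
    from near obtain l where l: "(l, x) \<in> C" "l < ?g x + e" by blast
    from near obtain k where k: "(k, y) \<in> C" "k < ?g y + e" by blast
    have "((1 - t) * l + t * k, (1 - t) *\<^sub>R x + t *\<^sub>R y) \<in> C"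
      using convexD_alt[OF C l(1) k(1), of t] t by simp
    then have "?g ((1 - t) *\<^sub>R x + t *\<^sub>R y) \<le> (1 - t) * l + t * k"
      by (intro cInf_lower bdd) simp
    also have "\<dots> \<le> (1 - t) * (?g x + e) + t * (?g y + e)"
      using l k t by (intro add_mono mult_left_mono) auto
    also have "\<dots> = (1 - t) * ?g x + t * ?g y + e"
      by (simp add: algebra_simps)
    finally show "?g ((1 - t) *\<^sub>R x + t *\<^sub>R y) \<le> (1 - t) * ?g x + t * ?g y + e" .
  qed
qed simp

text \<open>
  The factors \<open>(l + 1) / 2\<close> and \<open>(l - 1) / 2\<close> rearranged as a midvalue and a half-width, so that
  joint affinity in \<open>l\<close> and \<open>x\<close> becomes visible.
\<close>

lemma mem_scaled_layer_iff:
  defines "m K v \<equiv> (support_fun K v - support_fun K (- v)) / 2"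
    and "w K v \<equiv> (support_fun K v + support_fun K (- v)) / 2"
  shows "x \<in> scaled_layer l K v \<longleftrightarrow>
    m K v \<le> blinfun_apply v x + l * w K v \<and> blinfun_apply v x - l * w K v \<le> m K v"
  unfolding scaled_layer_def Let_def m_def w_def by (auto simp: field_simps)

lemma convex_scaled_layer_graph: "convex {(l, x). x \<in> scaled_layer l K v}"
proof -
  define m where "m = (support_fun K v - support_fun K (- v)) / 2"
  define w where "w = (support_fun K v + support_fun K (- v)) / 2"
  have "{(l, x). x \<in> scaled_layer l K v} =
      (\<lambda>(l, x). blinfun_apply v x + l * w) -` {m..} \<inter> (\<lambda>(l, x). blinfun_apply v x - l * w) -` {..m}"
    by (auto simp: mem_scaled_layer_iff m_def w_def)
  moreover have "linear (\<lambda>(l, x). blinfun_apply v x + l * w)"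
    "linear (\<lambda>(l, x). blinfun_apply v x - l * w)"
    by (auto intro!: linearI simp: blinfun.add_right blinfun.scaleR_right algebra_simps)
  ultimately show ?thesis
    by (auto intro!: convex_Int convex_linear_vimage)
qed

lemma convex_scaled_body_graph: "convex {(l, x). 0 \<le> l \<and> x \<in> scaled_body l K}"
proof -
  have "{(l, x). 0 \<le> l \<and> x \<in> scaled_body l K} =
      {0..} \<times> UNIV \<inter> (\<Inter>v\<in>dual_sphere. {(l, x). x \<in> scaled_layer l K v})"
    by (auto simp: scaled_body_def)
  then show ?thesis
    by (auto intro!: convex_Int convex_Times convex_INT convex_scaled_layer_graph)
qed

theorem proposition3p6:
  fixes K :: "'a::real_normed_vector set"
  assumes "(UNIV :: 'a set) \<noteq> {0}"
    and "convex_body K"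
  shows "convex_on UNIV (gen_minkowski K)"
proof -
  let ?C = "{(l, x). 0 \<le> l \<and> x \<in> scaled_body l K}"
  have "convex_on UNIV (\<lambda>x. Inf {l. (l, x) \<in> ?C})"
  proof (rule convex_on_Inf_fiber[OF convex_scaled_body_graph])
    show "{l. (l, x) \<in> ?C} \<noteq> {}" for x
      using minkowski_set_nonempty[OF assms(2), of x] by simp
    show "bdd_below {l. (l, x) \<in> ?C}" for x
      by (rule bdd_belowI[of _ 0]) simp
  qed
  then show ?thesis
    by (simp add: gen_minkowski_def[abs_def])
qed

end
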